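(* For every Banach space $X$ and every compact Hausdorff space $K$, the adjoint $T^* \colon X^* \longrightarrow C(K)^*$ of every weakly compact operator $T \colon C(K) \longrightarrow X$ is almost limited, hence $T^{**} \colon C(K)^{**} \longrightarrow X^{**}$ is almost Dunford-Pettis.
   Context: Operators are linear. $C(K)$ is the Banach lattice of continuous real functions on $K$ with the sup norm and pointwise order. An operator $S$ from a Banach space $Y$ to a Banach lattice $G$ is almost limited if $S^*$ sends disjoint weak$^*$-null sequences in $G^*$ to norm null sequences in $Y^*$. An operator from a Banach lattice to a Banach space is almost Dunford-Pettis if it sends disjoint weakly null sequences to norm null sequences (equivalently, positive disjoint weakly null sequences to norm null sequences). *)

theory Defs
  imports "HOL-Analysis.Analysis"
begin

section \<open>Duals, adjoints and weak topologies\<close>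

type_synonym 'a dual = "'a \<Rightarrow>\<^sub>L real"

text \<open>The name \<open>adjoint\<close> is taken in HOL-Analysis by the adjoint with respect to an inner product.\<close>

lift_definition dual_adjoint ::
    "('a::real_normed_vector \<Rightarrow>\<^sub>L 'b::real_normed_vector) \<Rightarrow> ('b dual \<Rightarrow>\<^sub>L 'a dual)"
  is "\<lambda>T f. f o\<^sub>L T"
  by (rule bounded_bilinear.bounded_linear_left[OF bounded_bilinear_blinfun_compose])

definition weak_topology :: "'a::real_normed_vector topology"
  where "weak_topology = pullback_topology UNIV (\<lambda>x (f :: 'a dual). blinfun_apply f x) euclidean"

text \<open>\<open>euclidean\<close> on a function type is the topology of pointwise convergence, so this is the initial
  topology for the evaluations at the points of \<open>'a\<close>, and an instance of the library's
  \<open>strong_operator_topology\<close>.\<close>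

definition weak_star_topology :: "'a::real_normed_vector dual topology"
  where "weak_star_topology = pullback_topology UNIV blinfun_apply euclidean"

lemma weak_star_topology_eq: "weak_star_topology = strong_operator_topology"
  by (simp add: weak_star_topology_def strong_operator_topology_def)

definition weakly_null :: "(nat \<Rightarrow> 'a::real_normed_vector) \<Rightarrow> bool"
  where "weakly_null x \<longleftrightarrow> limitin weak_topology x 0 sequentially"

definition weak_star_null :: "(nat \<Rightarrow> 'a::real_normed_vector dual) \<Rightarrow> bool"
  where "weak_star_null f \<longleftrightarrow> limitin weak_star_topology f 0 sequentially"

definition norm_null :: "(nat \<Rightarrow> 'a::real_normed_vector) \<Rightarrow> bool"
  where "norm_null x \<longleftrightarrow> x \<longlonglongrightarrow> 0"

lemma limitin_pullback_euclidean:
  fixes g :: "'a \<Rightarrow> 'b::topological_space"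
  shows "limitin (pullback_topology UNIV g euclidean) x l F \<longleftrightarrow> ((\<lambda>n. g (x n)) \<longlongrightarrow> g l) F"
proof -
  have top: "openin (pullback_topology UNIV g euclidean) U \<longleftrightarrow> (\<exists>V. open V \<and> U = g -` V)" for U
    by (simp add: openin_pullback_topology)
  have "l \<in> topspace (pullback_topology UNIV g euclidean)"
    by (simp add: topspace_pullback_topology)
  then have "limitin (pullback_topology UNIV g euclidean) x l F \<longleftrightarrow>
      (\<forall>V. open V \<and> l \<in> g -` V \<longrightarrow> (\<forall>\<^sub>F n in F. x n \<in> g -` V))"
    unfolding limitin_def top by blast
  then show ?thesis
    by (simp add: tendsto_def imp_conjL)
qed

lemma tendsto_componentwise_iff_fun:
  fixes f :: "'a \<Rightarrow> 'b \<Rightarrow> 'c::topological_space"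
  shows "(f \<longlongrightarrow> l) F \<longleftrightarrow> (\<forall>i. ((\<lambda>n. f n i) \<longlongrightarrow> l i) F)"
  using limitin_componentwise[of "\<lambda>_. euclidean" UNIV f l F]
  by (simp add: euclidean_product_topology)

lemma weakly_null_iff: "weakly_null x \<longleftrightarrow> (\<forall>f :: 'a::real_normed_vector dual. (\<lambda>n. f (x n)) \<longlonglongrightarrow> 0)"
  by (simp add: weakly_null_def weak_topology_def limitin_pullback_euclidean
      tendsto_componentwise_iff_fun)

lemma weak_star_null_iff:
  "weak_star_null f \<longleftrightarrow> (\<forall>x :: 'a::real_normed_vector. (\<lambda>n. f n x) \<longlonglongrightarrow> 0)"
  by (simp add: weak_star_null_def weak_star_topology_def limitin_pullback_euclidean
      tendsto_componentwise_iff_fun)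

definition weakly_compact_operator ::
    "('a::real_normed_vector \<Rightarrow>\<^sub>L 'b::real_normed_vector) \<Rightarrow> bool"
  where "weakly_compact_operator T \<longleftrightarrow>
    compactin weak_topology (weak_topology closure_of (blinfun_apply T ` cball 0 1))"


section \<open>Vector lattice notions\<close>

text \<open>The dual of a Banach lattice cannot carry its order by type class instantiation, because
  \<open>blinfun\<close> is a binary type constructor and an instance cannot be restricted to the codomain
  \<open>real\<close>. The lattice order is therefore an explicit argument \<open>le\<close>, which is to be instantiated only
  with the order of a Banach lattice.\<close>

definition is_sup :: "('a \<Rightarrow> 'a \<Rightarrow> bool) \<Rightarrow> 'a set \<Rightarrow> 'a \<Rightarrow> bool"
  where "is_sup le A s \<longleftrightarrow> (\<forall>x\<in>A. le x s) \<and> (\<forall>u. (\<forall>x\<in>A. le x u) \<longrightarrow> le s u)"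

definition is_inf :: "('a \<Rightarrow> 'a \<Rightarrow> bool) \<Rightarrow> 'a set \<Rightarrow> 'a \<Rightarrow> bool"
  where "is_inf le A s \<longleftrightarrow> (\<forall>x\<in>A. le s x) \<and> (\<forall>u. (\<forall>x\<in>A. le u x) \<longrightarrow> le u s)"

text \<open>\<open>is_modulus le x a\<close> says \<open>a = \<bar>x\<bar> = x \<squnion> (-x)\<close>, and \<open>lattice_disjoint le x y\<close> says
  \<open>\<bar>x\<bar> \<sqinter> \<bar>y\<bar> = 0\<close>. In a vector lattice the moduli exist and are
  unique, so the existential quantifiers below merely name them.\<close>

definition is_modulus :: "('a::real_normed_vector \<Rightarrow> 'a \<Rightarrow> bool) \<Rightarrow> 'a \<Rightarrow> 'a \<Rightarrow> bool"
  where "is_modulus le x a \<longleftrightarrow> is_sup le {x, - x} a"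

definition lattice_disjoint :: "('a::real_normed_vector \<Rightarrow> 'a \<Rightarrow> bool) \<Rightarrow> 'a \<Rightarrow> 'a \<Rightarrow> bool"
  where "lattice_disjoint le x y \<longleftrightarrow>
    (\<exists>a b. is_modulus le x a \<and> is_modulus le y b \<and> is_inf le {a, b} 0)"

definition disjoint_sequence :: "('a::real_normed_vector \<Rightarrow> 'a \<Rightarrow> bool) \<Rightarrow> (nat \<Rightarrow> 'a) \<Rightarrow> bool"
  where "disjoint_sequence le x \<longleftrightarrow> (\<forall>m n. m \<noteq> n \<longrightarrow> lattice_disjoint le (x m) (x n))"

definition pointwise_le :: "('k::topological_space \<Rightarrow>\<^sub>C real) \<Rightarrow> ('k \<Rightarrow>\<^sub>C real) \<Rightarrow> bool"
  where "pointwise_le f g \<longleftrightarrow> (\<forall>t. apply_bcontfun f t \<le> apply_bcontfun g t)"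

definition dual_le ::
    "('a::real_normed_vector \<Rightarrow> 'a \<Rightarrow> bool) \<Rightarrow> 'a dual \<Rightarrow> 'a dual \<Rightarrow> bool"
  where "dual_le le f g \<longleftrightarrow> (\<forall>x. le 0 x \<longrightarrow> blinfun_apply f x \<le> blinfun_apply g x)"


section \<open>Classes of operators\<close>

text \<open>In \<open>almost_limited\<close> the order \<open>le\<close> is that of the codomain, in \<open>almost_dunford_pettis\<close> that of
  the domain.\<close>

definition almost_limited ::
    "('g::real_normed_vector \<Rightarrow> 'g \<Rightarrow> bool) \<Rightarrow> ('y::real_normed_vector \<Rightarrow>\<^sub>L 'g) \<Rightarrow> bool"
  where "almost_limited le S \<longleftrightarrow>
    (\<forall>f :: nat \<Rightarrow> 'g dual. disjoint_sequence (dual_le le) f \<and> weak_star_null f \<longrightarrow>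
       norm_null (\<lambda>n. dual_adjoint S (f n)))"

definition almost_dunford_pettis ::
    "('g::real_normed_vector \<Rightarrow> 'g \<Rightarrow> bool) \<Rightarrow> ('g \<Rightarrow>\<^sub>L 'y::real_normed_vector) \<Rightarrow> bool"
  where "almost_dunford_pettis le S \<longleftrightarrow>
    (\<forall>x :: nat \<Rightarrow> 'g. disjoint_sequence le x \<and> weakly_null x \<longrightarrow> norm_null (\<lambda>n. S (x n)))"

end

theory Submission
  imports Defs
begin

text \<open>
  The bidual of \<open>C(K)\<close> is a lattice with order unit \<open>\<mu> \<mapsto> \<mu> 1\<close>. The moduli of a disjoint
  sequence \<open>f\<close> bounded in norm by \<open>C\<close> lie below \<open>C\<close> times this unit, and as they are
  disjoint, so do their finite sums (\<open>disjoint_sequence_sum_le\<close>). Evaluating at the positive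
  and negative parts of a functional \<open>\<mu>\<close> on \<open>C(K)\<close> (\<open>positive_part_exists\<close>) gives
  \<open>(\<Sum>m<N. \<bar>f m \<mu>\<bar>) \<le> 3 * C * norm \<mu>\<close> (\<open>disjoint_bounded_wuc\<close>): the series \<open>\<Sum>m. f m\<close> is
  weakly unconditionally Cauchy.

  The rest holds for weakly compact operators between arbitrary normed spaces: the biadjoint
  sends the terms of such a series to a norm null sequence
  (\<open>weakly_compact_biadjoint_null\<close>). Weak compactness enters through Gantmacher's theorem,
  that the biadjoint takes values in the codomain itself
  (\<open>weakly_compact_biadjoint_in_range\<close>). So the adjoint is continuous from the weak* to the
  weak topology, and the image of the dual ball, read as the set of sequences \<open>(f m \<mu>)\<^sub>m\<close>,
  is relatively weakly compact in \<open>\<ell>\<^sub>1\<close>. By Schur's theorem the tails of these sequences are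
  uniformly small, in particular their distant entries; \<open>schur_diagonal\<close> is the diagonal
  form of this that the proof uses.

  A weak* null sequence is bounded by the uniform boundedness principle, which gives the
  first claim. The second follows, because a weakly null sequence in the bidual is weak*
  null.
\<close>

section \<open>Bounded operators and functionals\<close>

lemma norm_blinfun_le_ball:
  assumes r: "r > 0" and ball: "\<And>x. norm x \<le> r \<Longrightarrow> norm (blinfun_apply g x) \<le> c * r"
  shows "norm g \<le> c"
proof (rule norm_blinfun_bound)
  have "0 \<le> c * r" using ball[of 0] r by simp
  then show "0 \<le> c" using r by (simp add: zero_le_mult_iff)
  fix x
  show "norm (g x) \<le> c * norm x"
  proof (cases "x = 0")
    case False
    define s where "s = r / norm x"
    have s: "s > 0" "s * norm x = r" using False r by (simp_all add: s_def)
    have "s * norm (g x) = norm (g (s *\<^sub>R x))"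
      using s(1) by (simp add: blinfun.scaleR_right)
    also have "\<dots> \<le> c * r" using s by (intro ball) simp
    finally have "s * norm (g x) \<le> s * (c * norm x)" by (simp add: s(2)[symmetric] mult.left_commute)
    then show ?thesis using s(1) by simp
  qed simp
qed

text \<open>The Banach--Steinhaus theorem, by Baire category: some set on which all \<open>f i\<close> are bounded
  by \<open>n\<close> contains a ball, and differences of its points fill a ball about the origin.\<close>

lemma uniform_boundedness:
  fixes f :: "'i \<Rightarrow> ('a::banach \<Rightarrow>\<^sub>L 'b::real_normed_vector)"
  assumes pw: "\<And>x. \<exists>K. \<forall>i. norm (f i x) \<le> K"
  obtains C where "\<And>i. norm (f i) \<le> C"
proof -
  define A where "A n = (\<Inter>i. {x. norm (f i x) \<le> real n})" for n
  have closed_A: "closed (A n)" for n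
    unfolding A_def by (intro closed_INT ballI closed_Collect_le continuous_on_const
      continuous_on_norm linear_continuous_on blinfun.bounded_linear_right)
  have union: "(\<Union>n. A n) = UNIV"
  proof -
    have "\<exists>n. x \<in> A n" for x
    proof -
      obtain K where K: "\<And>i. norm (f i x) \<le> K" using pw by blast
      obtain n where n: "K \<le> real n" using real_arch_simple by blast
      show ?thesis
        using order_trans[OF K n] by (auto simp: A_def)
    qed
    then show ?thesis by auto
  qed
  have "\<exists>n. interior (A n) \<noteq> {}"
  proof (rule ccontr)
    assume "\<not> ?thesis"
    then have "euclidean interior_of (\<Union>(range A)) = {}"
      by (intro Baire_category_alt disjI1 completely_metrizable_space_euclidean)
        (auto simp: closed_A simp flip: closed_closedin)
    then show False using union by simp
  qed
  then obtain n x where "x \<in> interior (A n)" by blast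
  then obtain r where r: "r > 0" "cball x r \<subseteq> A n"
    by (auto simp: mem_interior_cball)
  have "norm (f i) \<le> 2 * real n / r" for i
  proof (rule norm_blinfun_le_ball[OF r(1)])
    fix z :: 'a
    assume "norm z \<le> r"
    then have "x + z \<in> cball x r" "x \<in> cball x r"
      using r(1) by (simp_all add: dist_norm)
    then have "x + z \<in> A n" "x \<in> A n"
      using r(2) by blast+
    then have "norm (f i (x + z)) \<le> n" "norm (f i x) \<le> n" by (auto simp: A_def)
    moreover have "norm (f i z) = norm (f i (x + z) - f i x)" by (simp add: blinfun.add_right)
    ultimately have "norm (f i z) \<le> 2 * real n"
      using norm_triangle_ineq4[of "f i (x + z)" "f i x"] by linarith
    then show "norm (f i z) \<le> 2 * real n / r * r" using r(1) by simp
  qed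
  then show thesis using that by blast
qed

text \<open>The norm need not be attained on the unit ball; losing a factor of two leaves room for a
  point that works, and a constant factor does not matter for null sequences.\<close>

lemma norm_blinfun_le_double_value:
  fixes g :: "'a::real_normed_vector dual"
  obtains x where "norm x \<le> 1" "norm g \<le> 2 * \<bar>g x\<bar>"
proof (cases "g = 0")
  case True
  then show thesis using that[of 0] by simp
next
  case False
  have "\<exists>x. norm x \<le> 1 \<and> norm g \<le> 2 * \<bar>g x\<bar>"
  proof (rule ccontr)
    assume "\<not> ?thesis"
    then have neg: "2 * \<bar>g x\<bar> < norm g" if "norm x \<le> 1" for x
      using that by (meson not_le)
    have "norm g \<le> norm g / 2"
      by (rule norm_blinfun_le_ball[of 1]) (use neg in \<open>auto simp: less_imp_le mult.commute\<close>)
    then show False using False by simp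
  qed
  then show thesis using that by blast
qed

lemma evaluation_functional:
  fixes x :: "'a::real_normed_vector"
  obtains ev :: "'a dual dual" where "\<And>g. ev g = blinfun_apply g x"
proof (rule that)
  show "Blinfun (\<lambda>g. blinfun_apply g x) g = blinfun_apply g x" for g :: "'a dual"
    by (simp add: bounded_linear_Blinfun_apply[OF blinfun.bounded_linear_left])
qed

lemma dual_adjoint_apply [simp]: "dual_adjoint T g x = g (T x)"
  by transfer simp

section \<open>Weak* cluster points and the sliding hump\<close>

text \<open>Banach--Alaoglu. The dual ball need not be weak* sequentially compact, so a subsequence
  with a weak* limit may not exist; a finer filter along which the functionals converge
  always does, by Tychonoff's theorem for the product of the intervals of radius
  \<open>c * norm x\<close>.\<close>

lemma bounded_functionals_cluster:
  fixes g :: "'i \<Rightarrow> 'a::real_normed_vector dual"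
  assumes F: "F \<noteq> bot" and g: "\<And>i. norm (g i) \<le> c"
  obtains G \<phi> where "G \<le> F" "G \<noteq> bot" "\<And>x. ((\<lambda>i. g i x) \<longlongrightarrow> blinfun_apply \<phi> x) G"
proof -
  define S where "S = (PiE UNIV (\<lambda>x::'a. cball (0::real) (c * norm x)))"
  have "compactin (product_topology (\<lambda>_. euclidean) UNIV) S"
    unfolding S_def compactin_PiE by simp
  then have S: "compact S"
    by (simp add: euclidean_product_topology)
  have bound: "\<bar>g i x\<bar> \<le> c * norm x" for i x
    using norm_blinfun[of "g i" x] mult_right_mono[OF g[of i], of "norm x"] by simp
  let ?h = "\<lambda>i. blinfun_apply (g i)"
  have "\<forall>\<^sub>F z in filtermap ?h F. z \<in> S"
    by (simp add: eventually_filtermap S_def PiE_UNIV_domain bound)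
  moreover have "filtermap ?h F \<noteq> bot"
    using F by (simp add: filtermap_bot_iff)
  ultimately obtain f where f: "inf (nhds f) (filtermap ?h F) \<noteq> bot"
    using S unfolding compact_filter by blast
  \<comment> \<open>The part of \<open>F\<close> that \<open>?h\<close> maps towards the cluster point \<open>f\<close>.\<close>
  define G where "G = inf F (filtercomap ?h (nhds f))"
  have "G \<noteq> bot"
  proof
    assume "G = bot"
    then obtain Q P where QP: "eventually Q F" "eventually P (nhds f)" "\<And>i. Q i \<Longrightarrow> P (?h i) \<Longrightarrow> False"
      unfolding G_def trivial_limit_def eventually_inf eventually_filtercomap by blast
    have "\<forall>\<^sub>F z in filtermap ?h F. \<not> P z"
      unfolding eventually_filtermap by (rule eventually_mono[OF QP(1)]) (use QP(3) in blast)
    then have "inf (nhds f) (filtermap ?h F) = bot"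
      using QP(2) unfolding trivial_limit_def eventually_inf by blast
    with f show False by simp
  qed
  moreover have "G \<le> F" by (simp add: G_def)
  moreover have "filterlim ?h (nhds f) G"
    unfolding G_def by (metis filterlim_filtercomap filterlim_mono inf_le2 order_refl)
  then have lim: "((\<lambda>i. g i x) \<longlongrightarrow> f x) G" for x
    by (simp add: tendsto_componentwise_iff_fun)
  have "bounded_linear f"
  proof
    fix x y :: 'a and r :: real
    show "f (x + y) = f x + f y"
      using lim[of "x + y"] tendsto_add[OF lim[of x] lim[of y]] \<open>G \<noteq> bot\<close>
      by (auto simp: blinfun.add_right intro: tendsto_unique)
    show "f (r *\<^sub>R x) = r *\<^sub>R f x"
      using lim[of "r *\<^sub>R x"] tendsto_scaleR[OF tendsto_const lim[of x]] \<open>G \<noteq> bot\<close>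
      by (auto simp: blinfun.scaleR_right intro: tendsto_unique)
  next
    have "norm (f x) \<le> norm x * c" for x
      by (rule tendsto_upperbound[OF tendsto_norm[OF lim[of x]]])
        (use bound[of _ x] \<open>G \<noteq> bot\<close> in \<open>auto simp: mult.commute\<close>)
    then show "\<exists>K. \<forall>x. norm (f x) \<le> norm x * K" by blast
  qed
  ultimately show thesis
    using that[of G "Blinfun f"] lim by (simp add: bounded_linear_Blinfun_apply)
qed

text \<open>The sliding hump behind Schur's theorem that weakly compact subsets of \<open>\<ell>\<^sub>1\<close> are norm
  compact. The rows \<open>a k\<close> lie in \<open>\<ell>\<^sub>1\<close>, and every subfilter of the index filter has a
  refinement along which they converge against each indicator function of a set \<open>A\<close>. This is
  what Banach--Alaoglu provides in place of convergent subsequences.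

  If the diagonal is not null, fix a limit row \<open>b\<close> along indices with \<open>a k k\<close> large and pick
  indices \<open>k 0 < k 1 < \<dots>\<close> so that \<open>c = a - b\<close> has, in row \<open>k i\<close>, little mass up to
  \<open>k (i - 1)\<close> and from \<open>k (i + 1)\<close> on. Over \<open>A = range k\<close> the sum of row \<open>k i\<close> is then
  dominated by its diagonal entry and stays away from 0. Refining once more, along the
  chosen indices, gives a limit row \<open>b'\<close>; it is equal to \<open>b\<close> because the heads of the rows
  were made to tend to 0, so the sums over \<open>A\<close> do tend to 0 along the refinement, a
  contradiction.\<close>

lemma schur_diagonal:
  fixes a :: "nat \<Rightarrow> nat \<Rightarrow> real"
  assumes a: "\<And>k. summable (\<lambda>m. \<bar>a k m\<bar>)"
    and cluster: "\<And>F. F \<noteq> bot \<Longrightarrow> F \<le> sequentially \<Longrightarrow>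
      \<exists>G b. G \<noteq> bot \<and> G \<le> F \<and> summable (\<lambda>m. \<bar>b m\<bar>) \<and>
        (\<forall>A. ((\<lambda>k. \<Sum>m. of_bool (m \<in> A) * a k m) \<longlongrightarrow> (\<Sum>m. of_bool (m \<in> A) * b m)) G)"
  shows "(\<lambda>k. a k k) \<longlonglongrightarrow> 0"
proof (rule ccontr)
  assume "\<not> (\<lambda>k. a k k) \<longlonglongrightarrow> 0"
  then obtain e where "e > 0" and freq: "\<exists>\<^sub>F k in sequentially. \<bar>a k k\<bar> \<ge> 4 * e"
  proof -
    from \<open>\<not> (\<lambda>k. a k k) \<longlonglongrightarrow> 0\<close> obtain d where "d > 0"
      and d: "\<exists>\<^sub>F k in sequentially. d \<le> \<bar>a k k\<bar>"
      by (auto simp: tendsto_iff not_eventually not_less)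
    then show thesis using that[of "d / 4"] by simp
  qed
  have single: "(\<Sum>m. of_bool (m \<in> {j}) * x m) = x j" for x :: "nat \<Rightarrow> real" and j
    by (subst suminf_finite[of "{j}"]) auto
  define F where "F = inf sequentially (principal {k. \<bar>a k k\<bar> \<ge> 4 * e})"
  have "F \<noteq> bot"
    using freq by (auto simp: F_def trivial_limit_def eventually_inf_principal frequently_def)
  have F_le: "F \<le> sequentially" by (simp add: F_def)
  obtain G b where G: "G \<noteq> bot" "G \<le> F" and b: "summable (\<lambda>m. \<bar>b m\<bar>)"
    and lim: "\<And>A. ((\<lambda>k. \<Sum>m. of_bool (m \<in> A) * a k m) \<longlongrightarrow> (\<Sum>m. of_bool (m \<in> A) * b m)) G"
    using cluster[OF \<open>F \<noteq> bot\<close> F_le] by blast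
  from lim[of "{_}"] have aG: "((\<lambda>k. a k m) \<longlongrightarrow> b m) G" for m
    unfolding single .
  define c where "c k m = a k m - b m" for k m
  have c: "summable (\<lambda>m. \<bar>c k m\<bar>)" for k
    unfolding c_def
    by (rule summable_comparison_test'[OF summable_add[OF a[of k] b], of 0]) auto
  have cG: "((\<lambda>k. \<Sum>m\<le>x. \<bar>c k m\<bar>) \<longlongrightarrow> 0) G" for x
    unfolding c_def by (intro tendsto_null_sum tendsto_rabs_zero LIM_zero aG)
  have large: "\<forall>\<^sub>F k in G. x < k \<and> 3 * e \<le> \<bar>c k k\<bar>" for x
  proof -
    have "b \<longlonglongrightarrow> 0"
      using summable_LIMSEQ_zero[OF b] by (simp add: tendsto_rabs_zero_iff)
    then have "\<forall>\<^sub>F k in sequentially. \<bar>b k\<bar> < e"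
      using \<open>e > 0\<close> by (auto simp: tendsto_iff)
    then have "\<forall>\<^sub>F k in F. x < k \<and> \<bar>b k\<bar> < e \<and> 4 * e \<le> \<bar>a k k\<bar>"
      using eventually_gt_at_top[of x] unfolding F_def eventually_inf_principal
      by eventually_elim auto
    then have "\<forall>\<^sub>F k in G. x < k \<and> \<bar>b k\<bar> < e \<and> 4 * e \<le> \<bar>a k k\<bar>"
      using G(2) filter_leD by blast
    then show ?thesis by eventually_elim (auto simp: c_def)
  qed
  \<comment> \<open>The factor \<open>1 / Suc i\<close> makes every column of \<open>c\<close> vanish along the chosen rows; it serves
    to identify the second limit row with \<open>b\<close>.\<close>
  have "\<exists>k. \<forall>i. 3 * e \<le> \<bar>c (k i) (k i)\<bar> \<and> (k i < k (Suc i) \<and>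
      (\<Sum>m\<le>k i. \<bar>c (k (Suc i)) m\<bar>) < e / real (Suc i) \<and>
      (\<Sum>m. \<bar>c (k i) (m + k (Suc i))\<bar>) < e)"
  proof (rule dependent_nat_choice)
    show "\<exists>x. 3 * e \<le> \<bar>c x x\<bar>"
      using eventually_happens'[OF G(1) large[of 0]] by blast
  next
    fix x i
    have "(\<lambda>y. \<Sum>m. \<bar>c x (m + y)\<bar>) \<longlonglongrightarrow> 0"
      using suminf_exist_split2[OF c[of x]] .
    from order_tendstoD(2)[OF this \<open>e > 0\<close>]
    have "\<forall>\<^sub>F y in sequentially. (\<Sum>m. \<bar>c x (m + y)\<bar>) < e" .
    then have "\<forall>\<^sub>F y in G. (\<Sum>m. \<bar>c x (m + y)\<bar>) < e"
      by (rule filter_leD[OF order_trans[OF G(2) F_le]])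
    moreover have "\<forall>\<^sub>F y in G. (\<Sum>m\<le>x. \<bar>c y m\<bar>) < e / real (Suc i)"
      using order_tendstoD(2)[OF cG] \<open>e > 0\<close> by simp
    ultimately have "\<forall>\<^sub>F y in G. 3 * e \<le> \<bar>c y y\<bar> \<and> x < y \<and>
        (\<Sum>m\<le>x. \<bar>c y m\<bar>) < e / real (Suc i) \<and> (\<Sum>m. \<bar>c x (m + y)\<bar>) < e"
      using large[of x] by eventually_elim auto
    then show "\<exists>y. 3 * e \<le> \<bar>c y y\<bar> \<and> x < y \<and>
        (\<Sum>m\<le>x. \<bar>c y m\<bar>) < e / real (Suc i) \<and> (\<Sum>m. \<bar>c x (m + y)\<bar>) < e"
      by (rule eventually_happens'[OF G(1)])
  qed
  then obtain k where k: "\<And>i. 3 * e \<le> \<bar>c (k i) (k i)\<bar>" "\<And>i. k i < k (Suc i)"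
    and head: "\<And>i. (\<Sum>m\<le>k i. \<bar>c (k (Suc i)) m\<bar>) < e / real (Suc i)"
    and tail: "\<And>i. (\<Sum>m. \<bar>c (k i) (m + k (Suc i))\<bar>) < e"
    by auto
  have mono: "strict_mono k"
    using k(2) by (rule strict_monoI_Suc)
  define A where "A = range k"
  have A_gap: "m \<le> k i \<or> m = k (Suc i) \<or> k (Suc (Suc i)) \<le> m" if "m \<in> A" for m i
  proof -
    from that obtain j where "m = k j" by (auto simp: A_def)
    moreover have "j \<le> i \<or> j = Suc i \<or> Suc (Suc i) \<le> j" by auto
    ultimately show ?thesis using mono by (metis strict_mono_less_eq)
  qed
  \<comment> \<open>Row \<open>k (Suc i)\<close> over \<open>A\<close>: the diagonal entry is at least \<open>3 * e\<close>, head \<open>?L\<close> and tail \<open>?R\<close>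
    together are below \<open>2 * e\<close>.\<close>
  have hump: "e \<le> \<bar>\<Sum>m. of_bool (m \<in> A) * c (k (Suc i)) m\<bar>" for i
  proof -
    let ?d = "\<lambda>m. c (k (Suc i)) m" and ?K = "k (Suc i)"
    let ?L = "\<lambda>m. of_bool (m \<in> {..k i}) * \<bar>?d m\<bar>"
    let ?R = "\<lambda>m. of_bool (k (Suc (Suc i)) \<le> m) * \<bar>?d m\<bar>"
    have L: "?L sums (\<Sum>m\<le>k i. \<bar>?d m\<bar>)"
      using sums_finite[of "{..k i}" ?L] by simp
    have R: "?R sums (\<Sum>m. \<bar>?d (m + k (Suc (Suc i)))\<bar>)"
    proof -
      have "(\<lambda>m. \<bar>?d (m + k (Suc (Suc i)))\<bar>) sums (\<Sum>m. \<bar>?d (m + k (Suc (Suc i)))\<bar>)"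
        using summable_ignore_initial_segment[OF c] by (rule summable_sums)
      then show ?thesis
        using sums_iff_shift'[of ?R "k (Suc (Suc i))"] by simp
    qed
    have D: "(\<lambda>m. of_bool (m = ?K) * ?d m) sums ?d ?K"
      using sums_finite[of "{?K}" "\<lambda>m. of_bool (m = ?K) * ?d m"] by simp
    have S: "summable (\<lambda>m. of_bool (m \<in> A) * ?d m)"
      by (rule summable_comparison_test'[OF c[of ?K], of 0]) auto
    have LR: "(\<lambda>m. ?L m + ?R m) sums ((\<Sum>m\<le>k i. \<bar>?d m\<bar>) + (\<Sum>m. \<bar>?d (m + k (Suc (Suc i)))\<bar>))"
      by (rule sums_add[OF L R])
    have le: "\<bar>of_bool (m \<in> A) * ?d m - of_bool (m = ?K) * ?d m\<bar> \<le> ?L m + ?R m" for m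
      using A_gap[of m i] by (auto simp: of_bool_def A_def)
    have "\<bar>(\<Sum>m. of_bool (m \<in> A) * ?d m) - ?d ?K\<bar>
        = \<bar>\<Sum>m. of_bool (m \<in> A) * ?d m - of_bool (m = ?K) * ?d m\<bar>"
      using suminf_diff[OF S sums_summable[OF D]] sums_unique[OF D] by simp
    also have "\<dots> \<le> (\<Sum>m. ?L m + ?R m)"
      using norm_suminf_le[of "\<lambda>m. of_bool (m \<in> A) * ?d m - of_bool (m = ?K) * ?d m" "\<lambda>m. ?L m + ?R m"]
        le sums_summable[OF LR] by simp
    also have "\<dots> < e / real (Suc i) + e"
      using sums_unique[OF LR] head[of i] tail[of "Suc i"] by simp
    also have "\<dots> \<le> 2 * e"
      using \<open>e > 0\<close> by (simp add: field_simps)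
    finally show ?thesis using k(1)[of "Suc i"] by linarith
  qed
  define F' where "F' = filtermap (k \<circ> Suc) sequentially"
  have "filterlim (k \<circ> Suc) sequentially sequentially"
    using mono by (intro filterlim_subseq) (simp add: strict_mono_def)
  then have "F' \<le> sequentially" "F' \<noteq> bot"
    by (auto simp: F'_def filterlim_def filtermap_bot_iff)
  then obtain G' b' where G': "G' \<noteq> bot" "G' \<le> F'" and b': "summable (\<lambda>m. \<bar>b' m\<bar>)"
    and lim': "\<And>A. ((\<lambda>k. \<Sum>m. of_bool (m \<in> A) * a k m) \<longlongrightarrow> (\<Sum>m. of_bool (m \<in> A) * b' m)) G'"
    using cluster[OF \<open>F' \<noteq> bot\<close> \<open>F' \<le> sequentially\<close>] by blast
  have "b' m = b m" for m
  proof (rule tendsto_unique[OF G'(1)])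
    show "((\<lambda>k. a k m) \<longlongrightarrow> b' m) G'" using lim'[of "{m}"] unfolding single .
    have "(\<lambda>i. e / real (Suc i)) \<longlonglongrightarrow> 0"
      using tendsto_mult_right_zero[OF LIMSEQ_inverse_real_of_nat, of e] by (simp add: field_simps)
    moreover have "\<forall>\<^sub>F i in sequentially. norm (c (k (Suc i)) m) \<le> e / real (Suc i)"
      using eventually_ge_at_top[of m]
    proof eventually_elim
      case (elim i)
      then have "m \<le> k i" using seq_suble[OF mono, of i] by simp
      then have "\<bar>c (k (Suc i)) m\<bar> \<le> (\<Sum>m\<le>k i. \<bar>c (k (Suc i)) m\<bar>)"
        by (intro member_le_sum) auto
      then show ?case using head[of i] by simp
    qed
    ultimately have "(\<lambda>i. c (k (Suc i)) m) \<longlonglongrightarrow> 0"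
      by (rule Lim_null_comparison[rotated])
    then have "((\<lambda>k. c k m) \<longlongrightarrow> 0) F'"
      by (simp add: F'_def filterlim_filtermap o_def)
    then have "((\<lambda>k. c k m + b m) \<longlongrightarrow> 0 + b m) G'"
      by (intro tendsto_intros) (rule filterlim_mono[OF _ order_refl G'(2)])
    then show "((\<lambda>k. a k m) \<longlongrightarrow> b m) G'" by (simp add: c_def)
  qed
  then have [simp]: "b' = b" by auto
  have "((\<lambda>k. (\<Sum>m. of_bool (m \<in> A) * a k m) - (\<Sum>m. of_bool (m \<in> A) * b m)) \<longlongrightarrow> 0) G'"
    using LIM_zero[OF lim'[of A]] by simp
  moreover have "(\<Sum>m. of_bool (m \<in> A) * a k m) - (\<Sum>m. of_bool (m \<in> A) * b m)
      = (\<Sum>m. of_bool (m \<in> A) * c k m)" for k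
    unfolding c_def right_diff_distrib
    by (rule suminf_diff;
        rule summable_comparison_test'[of _ 0, OF a[of k]] summable_comparison_test'[OF b, of 0]; auto)
  ultimately have "((\<lambda>k. \<Sum>m. of_bool (m \<in> A) * c k m) \<longlongrightarrow> 0) G'" by simp
  then have "\<forall>\<^sub>F k in G'. \<bar>\<Sum>m. of_bool (m \<in> A) * c k m\<bar> < e"
    using \<open>e > 0\<close> by (auto simp: tendsto_iff)
  moreover have "\<forall>\<^sub>F k in F'. e \<le> \<bar>\<Sum>m. of_bool (m \<in> A) * c k m\<bar>"
    using hump by (simp add: F'_def eventually_filtermap)
  then have "\<forall>\<^sub>F k in G'. e \<le> \<bar>\<Sum>m. of_bool (m \<in> A) * c k m\<bar>"
    using G'(2) filter_leD by blast
  ultimately have "\<forall>\<^sub>F k in G'. False" by eventually_elim auto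
  with G'(1) show False by simp
qed

section \<open>Biadjoints of weakly compact operators\<close>

text \<open>Helly's lemma, the finite form of Goldstine's theorem, without separation of convex sets.
  Choose \<open>x\<close> in the unit ball nearly minimising the sum \<open>q\<close> of the squared errors
  \<open>a \<mu> = F \<mu> - \<mu> x\<close>. Since the ball is convex, a nearly minimal \<open>x\<close> nearly maximises the
  functional \<open>\<nu> = (\<Sum>\<mu>\<in>M. a \<mu> *\<^sub>R \<mu>)\<close> over the ball, so \<open>norm \<nu>\<close> exceeds \<open>\<nu> x\<close> only slightly.
  But \<open>\<nu> x + q x = F \<nu> \<le> norm \<nu>\<close>, hence \<open>q x\<close> is small.\<close>

lemma helly_approximation:
  fixes F :: "'a::real_normed_vector dual dual" and M :: "'a dual set"
  assumes F: "norm F \<le> 1" and M: "finite M" and e: "e > 0"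
  obtains x where "norm x \<le> 1" "\<And>\<mu>. \<mu> \<in> M \<Longrightarrow> \<bar>\<mu> x - F \<mu>\<bar> < e"
proof -
  define q where "q x = (\<Sum>\<mu>\<in>M. (F \<mu> - blinfun_apply \<mu> x)\<^sup>2)" for x
  define B where "B = (\<Sum>\<mu>\<in>M. (2 * norm \<mu>)\<^sup>2)"
  define d where "d = Inf (q ` cball 0 1)"
  have q0: "0 \<le> q x" for x by (simp add: q_def sum_nonneg)
  have B0: "0 \<le> B" by (simp add: B_def sum_nonneg)
  have bdd: "bdd_below (q ` cball 0 1)" using q0 by (auto intro!: bdd_belowI[of _ 0])
  have d_le: "d \<le> q x" if "norm x \<le> 1" for x
    unfolding d_def using that bdd by (intro cINF_lower) auto
  \<comment> \<open>The step length for the variation of \<open>x\<close>. Within \<open>t\<^sup>2\<close> of the minimum the error in the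
    variational inequality is of order \<open>t\<close>.\<close>
  define t where "t = min 1 (e\<^sup>2 / (2 * (2 + B)))"
  have t: "0 < t" "t \<le> 1" using e B0 by (auto simp: t_def)
  have te: "t * (2 + B) < e\<^sup>2"
  proof -
    have "t * (2 + B) \<le> e\<^sup>2 / (2 * (2 + B)) * (2 + B)"
      using B0 by (intro mult_right_mono) (auto simp: t_def)
    also have "\<dots> = e\<^sup>2 / 2" using B0 by (simp add: divide_simps)
    also have "\<dots> < e\<^sup>2" using e by simp
    finally show ?thesis .
  qed
  have "d < d + t\<^sup>2" using t by simp
  then obtain x where x: "norm x \<le> 1" "q x < d + t\<^sup>2"
    using cInf_less_iff[OF _ bdd, of "d + t\<^sup>2"] unfolding d_def[symmetric] by auto
  define a where "a \<mu> = F \<mu> - blinfun_apply \<mu> x" for \<mu> :: "'a dual"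
  define \<nu> where "\<nu> = (\<Sum>\<mu>\<in>M. a \<mu> *\<^sub>R \<mu>)"
  have \<nu>: "\<nu> y = (\<Sum>\<mu>\<in>M. a \<mu> * blinfun_apply \<mu> y)" for y
    by (simp add: \<nu>_def blinfun.sum_left blinfun.scaleR_left)
  have F\<nu>: "F \<nu> = (\<Sum>\<mu>\<in>M. a \<mu> * F \<mu>)"
    by (simp add: \<nu>_def blinfun.sum_right blinfun.scaleR_right)
  \<comment> \<open>Compare \<open>q\<close> at \<open>x\<close> and at the point \<open>z\<close> on the segment to \<open>y\<close>.\<close>
  have var: "\<nu> y \<le> \<nu> x + t * (1 + B) / 2" if y: "norm y \<le> 1" for y
  proof -
    define z where "z = (1 - t) *\<^sub>R x + t *\<^sub>R y"
    have "norm z \<le> (1 - t) * norm x + t * norm y"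
      unfolding z_def using t by (intro order_trans[OF norm_triangle_ineq]) simp
    also have "\<dots> \<le> (1 - t) * 1 + t * 1"
      using t x y by (intro add_mono mult_left_mono) auto
    finally have "norm z \<le> 1" by simp
    have dB: "(\<Sum>\<mu>\<in>M. (blinfun_apply \<mu> y - blinfun_apply \<mu> x)\<^sup>2) \<le> B"
      unfolding B_def
    proof (rule sum_mono)
      fix \<mu> :: "'a dual"
      have "\<bar>\<mu> y - \<mu> x\<bar> \<le> norm \<mu> * norm (y - x)"
        using norm_blinfun[of \<mu> "y - x"] by (simp add: blinfun.diff_right)
      also have "\<dots> \<le> norm \<mu> * 2"
        using x y norm_triangle_ineq4[of y x] by (intro mult_left_mono) auto
      finally show "(\<mu> y - \<mu> x)\<^sup>2 \<le> (2 * norm \<mu>)\<^sup>2"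
        by (intro abs_le_square_iff[THEN iffD1]) simp
    qed
    have "q z = (\<Sum>\<mu>\<in>M. (a \<mu> - t * (blinfun_apply \<mu> y - blinfun_apply \<mu> x))\<^sup>2)"
      unfolding q_def a_def z_def
      by (intro sum.cong refl arg_cong[where f = "\<lambda>u. u\<^sup>2"])
        (simp add: blinfun.add_right blinfun.scaleR_right left_diff_distrib right_diff_distrib)
    also have "\<dots> = (\<Sum>\<mu>\<in>M. (a \<mu>)\<^sup>2
        - 2 * t * (a \<mu> * blinfun_apply \<mu> y - a \<mu> * blinfun_apply \<mu> x)
        + t\<^sup>2 * (blinfun_apply \<mu> y - blinfun_apply \<mu> x)\<^sup>2)"
      by (intro sum.cong refl) (simp add: power2_eq_square algebra_simps)
    also have "\<dots> = q x - 2 * t * (\<nu> y - \<nu> x)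
        + t\<^sup>2 * (\<Sum>\<mu>\<in>M. (blinfun_apply \<mu> y - blinfun_apply \<mu> x)\<^sup>2)"
      by (simp add: sum.distrib sum_subtractf sum_distrib_left[symmetric] \<nu> q_def a_def)
    also have "\<dots> \<le> q x - 2 * t * (\<nu> y - \<nu> x) + t\<^sup>2 * B"
      using dB by (simp add: mult_left_mono)
    finally have "2 * t * (\<nu> y - \<nu> x) \<le> t\<^sup>2 * (1 + B)"
      using d_le[OF \<open>norm z \<le> 1\<close>] x(2) by (simp add: algebra_simps)
    then have "t * (2 * (\<nu> y - \<nu> x)) \<le> t * (t * (1 + B))"
      by (simp add: power2_eq_square algebra_simps)
    then have "2 * (\<nu> y - \<nu> x) \<le> t * (1 + B)" using t by simp
    then show ?thesis by simp
  qed
  have "norm \<nu> \<le> \<nu> x + t * (1 + B) / 2"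
  proof (rule norm_blinfun_le_ball[of 1])
    fix y :: 'a
    assume "norm y \<le> 1"
    then show "norm (\<nu> y) \<le> (\<nu> x + t * (1 + B) / 2) * 1"
      using var[of y] var[of "- y"] by (simp add: blinfun.minus_right abs_le_iff)
  qed simp
  moreover have "F \<nu> \<le> norm \<nu>"
    using norm_blinfun[of F \<nu>] mult_right_mono[OF F, of "norm \<nu>"] by simp
  moreover have "F \<nu> = \<nu> x + q x"
    by (simp add: F\<nu> \<nu> q_def a_def sum.distrib[symmetric] power2_eq_square algebra_simps)
  ultimately have "q x \<le> t * (1 + B) / 2" by simp
  also have "\<dots> \<le> t * (2 + B)" using t B0 by (simp add: field_simps)
  also note te
  finally have qx: "q x < e\<^sup>2" .
  have "\<bar>\<mu> x - F \<mu>\<bar> < e" if "\<mu> \<in> M" for \<mu>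
  proof -
    have "(F \<mu> - \<mu> x)\<^sup>2 \<le> q x"
      unfolding q_def using M that by (intro member_le_sum) auto
    then have "(\<mu> x - F \<mu>)\<^sup>2 < e\<^sup>2" using qx by (simp add: power2_commute)
    then show ?thesis using e by (intro power2_less_imp_less[of "\<bar>_\<bar>" e]) auto
  qed
  with x(1) show thesis using that by blast
qed

lemma closedin_weak_preimage:
  fixes g :: "'a::real_normed_vector dual"
  assumes "closed S"
  shows "closedin weak_topology {y. g y \<in> S}"
proof -
  have "open {h :: 'a dual \<Rightarrow> real. h g \<in> - S}"
    using open_vimage[OF open_Compl[OF assms] continuous_on_product_coordinates, of g]
    by (simp add: vimage_def)
  then have "openin weak_topology {y. g y \<in> - S}"
    unfolding weak_topology_def openin_pullback_topology
    by (intro exI[of _ "{h. h g \<in> - S}"]) auto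
  moreover have "topspace (weak_topology :: 'a topology) = UNIV"
    by (simp add: weak_topology_def topspace_pullback_topology)
  moreover have "UNIV - {y. g y \<in> S} = {y. g y \<in> - S}" by auto
  ultimately show ?thesis by (simp add: closedin_def)
qed

text \<open>The half of Gantmacher's theorem that matters here: the biadjoint of a weakly compact
  operator takes its values in the canonical image of the codomain. For \<open>F\<close> in the unit
  ball, the conditions \<open>\<bar>F (dual_adjoint T g) - g y\<bar> \<le> 1 / Suc n\<close> on \<open>y\<close> define weakly
  closed sets; by Helly's lemma finitely many of them meet the image of the unit ball, and
  weak compactness of its closure gives a \<open>y\<close> meeting all of them.\<close>

lemma weakly_compact_biadjoint_in_range:
  fixes T :: "'a::real_normed_vector \<Rightarrow>\<^sub>L 'b::real_normed_vector"
    and F :: "'a dual dual"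
  assumes T: "weakly_compact_operator T"
  obtains y where "\<And>g. F (dual_adjoint T g) = blinfun_apply g y"
proof -
  have ball: "\<exists>y. \<forall>g. F (dual_adjoint T g) = blinfun_apply g y" if F: "norm F \<le> 1" for F :: "'a dual dual"
  proof -
    define W where "W = weak_topology closure_of (blinfun_apply T ` cball 0 1)"
    define C where "C g n = {y. g y \<in> cball (F (dual_adjoint T g)) (1 / real (Suc n))}" for g :: "'b dual" and n
    have W: "compactin weak_topology W" using T by (simp add: W_def weakly_compact_operator_def)
    have closed_C: "closedin weak_topology (C g n)" for g n
      unfolding C_def by (rule closedin_weak_preimage) simp
    have fip: "W \<inter> \<Inter>\<F> \<noteq> {}" if fin: "finite \<F>" "\<F> \<subseteq> range (case_prod C)" for \<F>
    proof -
      obtain P where P: "finite P" "\<F> = case_prod C ` P"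
        using finite_subset_image[OF fin] by (elim exE conjE) (rule that)
      define N where "N = Max (insert 0 (snd ` P))"
      obtain x where x: "norm x \<le> 1"
        "\<And>\<mu>. \<mu> \<in> (dual_adjoint T \<circ> fst) ` P \<Longrightarrow> \<bar>\<mu> x - F \<mu>\<bar> < 1 / real (Suc N)"
        by (rule helly_approximation[OF F finite_imageI[OF P(1)], of "1 / real (Suc N)" "dual_adjoint T \<circ> fst"])
          (simp, rule that)
      have "T x \<in> C g n" if "(g, n) \<in> P" for g n
      proof -
        have "n \<le> N"
          unfolding N_def using P(1) imageI[OF that, of snd] by (intro Max_ge) simp_all
        then have "1 / real (Suc N) \<le> 1 / real (Suc n)" by (simp add: frac_le)
        moreover have "\<bar>dual_adjoint T g x - F (dual_adjoint T g)\<bar> < 1 / real (Suc N)"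
          using imageI[OF that, of "dual_adjoint T \<circ> fst"] by (intro x(2)) simp
        ultimately show ?thesis
          unfolding C_def mem_Collect_eq mem_cball dist_real_def dual_adjoint_apply by linarith
      qed
      moreover have "T x \<in> W"
        unfolding W_def
        by (rule subsetD[OF closure_of_subset])
          (use x(1) in \<open>simp_all add: weak_topology_def topspace_pullback_topology\<close>)
      ultimately show ?thesis using P(2) by auto
    qed
    have "W \<inter> \<Inter>(range (case_prod C)) \<noteq> {}"
    proof (rule W[unfolded compactin_fip, THEN conjunct2, THEN spec, THEN mp], intro conjI ballI allI impI)
      show "closedin weak_topology S" if "S \<in> range (case_prod C)" for S
        using that closed_C by (elim rangeE) (simp add: split_beta)
      show "W \<inter> \<Inter>\<F> \<noteq> {}" if "finite \<F> \<and> \<F> \<subseteq> range (case_prod C)" for \<F>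
        using that by (intro fip) simp_all
    qed
    then obtain y where "y \<in> \<Inter>(range (case_prod C))" by blast
    then have y: "y \<in> C g n" for g n
      by (rule InterD) (rule range_eqI[of _ _ "(g, n)"], simp)
    have "F (dual_adjoint T g) = g y" for g :: "'b dual"
    proof (rule ccontr)
      assume "F (dual_adjoint T g) \<noteq> g y"
      then have "0 < dist (F (dual_adjoint T g)) (g y)" by simp
      then obtain n where "1 / real (Suc n) < dist (F (dual_adjoint T g)) (g y)"
        by (rule nat_approx_posE)
      moreover have "dist (F (dual_adjoint T g)) (g y) \<le> 1 / real (Suc n)"
        using y[of g n] unfolding C_def mem_Collect_eq mem_cball .
      ultimately show False by linarith
    qed
    then show ?thesis by blast
  qed
  show thesis
  proof (cases "F = 0")
    case True
    then show thesis using that[of 0] by simp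
  next
    case False
    then obtain y where y: "\<And>g. (F /\<^sub>R norm F) (dual_adjoint T g) = blinfun_apply g y"
      using ball[of "F /\<^sub>R norm F"] by auto
    then have "F (dual_adjoint T g) = g (norm F *\<^sub>R y)" for g :: "'b dual"
      using False by (simp add: blinfun.scaleR_left blinfun.scaleR_right y[symmetric])
    then show thesis using that by blast
  qed
qed

text \<open>The hypothesis on \<open>f\<close> says that \<open>\<Sum>m. f m\<close> is weakly unconditionally Cauchy. Choose
  functionals \<open>g k\<close> in the dual ball nearly norming the image of \<open>f k\<close>, and put
  \<open>a k m = f m (dual_adjoint T (g k))\<close>; it suffices that the diagonal of \<open>a\<close> is null. For
  every set \<open>A\<close> the partial series over \<open>A\<close> defines a bidual element \<open>FA\<close>, which the
  biadjoint of \<open>T\<close> sends to a point \<open>y\<close> of the codomain. So the sum of the row \<open>a k\<close> over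
  \<open>A\<close> is \<open>g k y\<close>, and weak* convergence of \<open>g k\<close> along a filter, which tests only points of
  the codomain, makes these sums converge.\<close>

lemma weakly_compact_biadjoint_null:
  fixes T :: "'a::real_normed_vector \<Rightarrow>\<^sub>L 'b::real_normed_vector"
    and f :: "nat \<Rightarrow> 'a dual dual"
  assumes T: "weakly_compact_operator T"
    and wuc: "\<And>N \<mu>. (\<Sum>m<N. \<bar>f m \<mu>\<bar>) \<le> M * norm \<mu>"
  shows "(\<lambda>n. dual_adjoint (dual_adjoint T) (f n)) \<longlonglongrightarrow> 0"
proof -
  have summ: "summable (\<lambda>m. \<bar>f m \<mu>\<bar>)" for \<mu>
    by (rule bounded_imp_summable[OF _ wuc[where N = "Suc _" and \<mu> = \<mu>, unfolded lessThan_Suc_atMost]]) simp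
  have summA: "summable (\<lambda>m. of_bool (m \<in> A) * f m \<mu>)" for A \<mu>
    by (rule summable_comparison_test'[OF summ[of \<mu>], of 0]) auto
  have partial_sums: "\<exists>F :: 'a dual dual. \<forall>\<mu>. F \<mu> = (\<Sum>m. of_bool (m \<in> A) * f m \<mu>)" for A
  proof -
    define h where "h \<mu> = (\<Sum>m. of_bool (m \<in> A) * f m \<mu>)" for \<mu>
    have "bounded_linear h"
    proof
      fix \<mu> \<nu> :: "'a dual" and r :: real
      show "h (\<mu> + \<nu>) = h \<mu> + h \<nu>"
        using suminf_add[OF summA[of A \<mu>] summA[of A \<nu>]]
        by (simp add: h_def blinfun.add_right algebra_simps)
      show "h (r *\<^sub>R \<mu>) = r *\<^sub>R h \<mu>"
        using suminf_mult[OF summA[of A \<mu>], of r]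
        by (simp add: h_def blinfun.scaleR_right algebra_simps)
    next
      have "norm (h \<mu>) \<le> norm \<mu> * M" for \<mu>
      proof -
        have "norm (h \<mu>) \<le> (\<Sum>m. \<bar>f m \<mu>\<bar>)"
          unfolding h_def by (rule norm_suminf_le[OF _ summ]) auto
        also have "\<dots> \<le> M * norm \<mu>"
          by (rule suminf_le_const[OF summ wuc])
        finally show ?thesis by (simp add: mult.commute)
      qed
      then show "\<exists>K. \<forall>\<mu>. norm (h \<mu>) \<le> norm \<mu> * K" by blast
    qed
    then show ?thesis by (intro exI[of _ "Blinfun h"]) (simp add: bounded_linear_Blinfun_apply h_def)
  qed
  have "\<exists>g :: 'b dual. norm g \<le> 1 \<and>
      norm (dual_adjoint (dual_adjoint T) (f k)) \<le> 2 * \<bar>f k (dual_adjoint T g)\<bar>" for k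
    by (rule norm_blinfun_le_double_value[of "dual_adjoint (dual_adjoint T) (f k)"]) auto
  then obtain g where g: "\<And>k. norm (g k) \<le> 1"
    and norming: "\<And>k. norm (dual_adjoint (dual_adjoint T) (f k)) \<le> 2 * \<bar>f k (dual_adjoint T (g k))\<bar>"
    by metis
  have "(\<lambda>k. f k (dual_adjoint T (g k))) \<longlonglongrightarrow> 0"
  proof (rule schur_diagonal[where a = "\<lambda>k m. f m (dual_adjoint T (g k))"])
    show "summable (\<lambda>m. \<bar>f m (dual_adjoint T (g k))\<bar>)" for k by (rule summ)
  next
    fix F :: "nat filter"
    assume "F \<noteq> bot" "F \<le> sequentially"
    obtain G \<phi> where G: "G \<le> F" "G \<noteq> bot"
      and lim: "\<And>x. ((\<lambda>i. g i x) \<longlongrightarrow> blinfun_apply \<phi> x) G"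
      by (rule bounded_functionals_cluster[where g = g, OF \<open>F \<noteq> bot\<close> g]) (rule that)
    have "((\<lambda>k. \<Sum>m. of_bool (m \<in> A) * f m (dual_adjoint T (g k))) \<longlongrightarrow>
        (\<Sum>m. of_bool (m \<in> A) * f m (dual_adjoint T \<phi>))) G" for A
    proof -
      obtain FA :: "'a dual dual" where FA: "\<And>\<mu>. FA \<mu> = (\<Sum>m. of_bool (m \<in> A) * f m \<mu>)"
        using partial_sums by blast
      obtain y where "\<And>g. FA (dual_adjoint T g) = blinfun_apply g y"
        by (rule weakly_compact_biadjoint_in_range[where F = FA, OF T]) (rule that)
      then show ?thesis using lim[of y] by (simp flip: FA)
    qed
    with G summ[of "dual_adjoint T \<phi>"]
    show "\<exists>G b. G \<noteq> bot \<and> G \<le> F \<and> summable (\<lambda>m. \<bar>b m\<bar>) \<and>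
        (\<forall>A. ((\<lambda>k. \<Sum>m. of_bool (m \<in> A) * f m (dual_adjoint T (g k))) \<longlongrightarrow>
          (\<Sum>m. of_bool (m \<in> A) * b m)) G)"
      by (intro exI[of _ G] exI[of _ "\<lambda>m. f m (dual_adjoint T \<phi>)"]) auto
  qed
  then have "(\<lambda>k. 2 * \<bar>f k (dual_adjoint T (g k))\<bar>) \<longlonglongrightarrow> 0"
    by (intro tendsto_mult_right_zero tendsto_rabs_zero)
  then show ?thesis
    by (rule Lim_null_comparison[rotated]) (simp add: norming)
qed

section \<open>Disjoint sequences in an ordered dual\<close>

text \<open>In a vector lattice the sum of pairwise disjoint positive elements is their supremum, so
  it is bounded by any common upper bound. The argument uses only the moduli and infima that
  disjointness names: for \<open>s\<close> and \<open>a\<close> disjoint and below \<open>u\<close>, the element \<open>s + a - u\<close> is a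
  lower bound of both, hence at most 0.\<close>

lemma disjoint_sequence_sum_le:
  fixes f :: "nat \<Rightarrow> 'e::real_normed_vector dual"
  assumes disj: "disjoint_sequence (dual_le le) f"
    and u: "\<And>n. dual_le le (f n) u" "\<And>n. dual_le le (- f n) u"
    and \<mu>: "le 0 \<mu>"
  shows "(\<Sum>m<N. \<bar>f m \<mu>\<bar>) \<le> u \<mu>"
proof -
  define D :: "'e dual \<Rightarrow> 'e dual \<Rightarrow> bool" where "D = dual_le le"
  have D_trans: "D x z" if "D x y" "D y z" for x y z
    using that unfolding D_def dual_le_def by (meson order_trans)
  have D_diff: "D (w - y) z \<longleftrightarrow> D w (y + z)" for w y z
    unfolding D_def dual_le_def by (simp add: blinfun.diff_left blinfun.add_left algebra_simps)
  have D_nonneg: "D w (y + w)" if "D 0 y" for w y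
    using that unfolding D_def dual_le_def by (simp add: blinfun.add_left)
  have "\<exists>a. is_modulus D (f m) a" for m
  proof -
    have "lattice_disjoint D (f m) (f (Suc m))"
      using disj unfolding disjoint_sequence_def D_def by (metis n_not_Suc_n)
    then show ?thesis unfolding lattice_disjoint_def by blast
  qed
  then obtain a where a: "\<And>m. is_modulus D (f m) (a m)" by metis
  have f_le_a: "D (f m) (a m)" "D (- f m) (a m)" for m
    using a[of m] by (simp_all add: is_modulus_def is_sup_def)
  have a_least: "D (a m) v" if "D (f m) v" "D (- f m) v" for m v
    using a[of m] that by (simp add: is_modulus_def is_sup_def)
  have a_le_u: "D (a m) u" for m
    using u[of m] by (intro a_least) (simp_all add: D_def)
  have a_nonneg: "D 0 (a m)" for m
    unfolding D_def dual_le_def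
  proof (intro allI impI)
    fix x assume "le 0 x"
    then have "f m x \<le> a m x" "- f m x \<le> a m x"
      using f_le_a[of m] by (simp_all add: D_def dual_le_def blinfun.minus_left)
    then show "blinfun_apply 0 x \<le> a m x" by simp
  qed
  \<comment> \<open>The hypothesis names a modulus of \<open>f m\<close> anew for each pair; each is above the chosen \<open>a m\<close>.\<close>
  have a_disj: "D w 0" if "m \<noteq> n" "D w (a m)" "D w (a n)" for m n w
  proof -
    have "lattice_disjoint D (f m) (f n)"
      using disj \<open>m \<noteq> n\<close> by (simp add: disjoint_sequence_def D_def)
    then obtain b c where b: "is_modulus D (f m) b" and c: "is_modulus D (f n) c"
      and inf: "is_inf D {b, c} 0"
      unfolding lattice_disjoint_def by blast
    have "D (a m) b" using b by (intro a_least) (simp_all add: is_modulus_def is_sup_def)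
    moreover have "D (a n) c" using c by (intro a_least) (simp_all add: is_modulus_def is_sup_def)
    ultimately have "D w b" "D w c" using D_trans that by blast+
    with inf show ?thesis by (simp add: is_inf_def)
  qed
  \<comment> \<open>If \<open>w\<close> lies below \<open>s + a N\<close> and \<open>a n\<close>, then \<open>w - a N\<close> lies below \<open>s\<close> and \<open>a n\<close>.\<close>
  have sum_disj: "D w 0" if "N \<le> n" "D w (\<Sum>m<N. a m)" "D w (a n)" for n w N
    using that
  proof (induction N arbitrary: w)
    case (Suc N)
    have "D (w - a N) (\<Sum>m<N. a m)" using Suc.prems(2) by (simp add: D_diff add.commute)
    moreover have "D (w - a N) (a n)"
      using D_trans[OF Suc.prems(3) D_nonneg[OF a_nonneg]] by (simp add: D_diff)
    ultimately have "D (w - a N) 0" using Suc.IH Suc.prems(1) by simp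
    then have "D w (a N)" by (simp add: D_diff)
    with Suc.prems(1,3) show ?case by (intro a_disj[of N n]) simp_all
  qed simp
  have "D (\<Sum>m<N. a m) u"
  proof (induction N)
    case 0
    show ?case using D_trans[OF a_nonneg a_le_u] by simp
  next
    case (Suc N)
    let ?w = "(\<Sum>m<Suc N. a m) - u"
    have "D ?w (\<Sum>m<N. a m)" "D ?w (a N)"
      using a_le_u[of N] Suc.IH unfolding D_def dual_le_def
      by (simp_all add: blinfun.diff_left blinfun.add_left)
    then have "D ?w 0" by (rule sum_disj[OF order_refl])
    then show ?case by (simp add: D_diff)
  qed
  then have "(\<Sum>m<N. a m \<mu>) \<le> u \<mu>"
    using \<mu> by (simp add: D_def dual_le_def blinfun.sum_left)
  moreover have "\<bar>f m \<mu>\<bar> \<le> a m \<mu>" for m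
    using f_le_a[of m] \<mu> by (simp add: D_def dual_le_def blinfun.minus_left abs_le_iff)
  then have "(\<Sum>m<N. \<bar>f m \<mu>\<bar>) \<le> (\<Sum>m<N. a m \<mu>)" by (intro sum_mono)
  ultimately show ?thesis by linarith
qed

section \<open>Functionals on continuous functions\<close>

lemma norm_le_of_order_interval:
  assumes "pointwise_le 0 z" "pointwise_le z x"
  shows "norm z \<le> norm x"
proof (rule norm_bound)
  fix t
  have "0 \<le> z t" "z t \<le> x t" using assms by (simp_all add: pointwise_le_def)
  then show "norm (z t) \<le> norm x" using norm_bounded[of x t] by simp
qed

lemma norm_const_bcontfun_le: "norm (const_bcontfun (c :: real)) \<le> \<bar>c\<bar>"
  by (rule norm_bound) (simp add: const_bcontfun.rep_eq)

lemma bcontfun_min: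
  fixes x z :: "'k::topological_space \<Rightarrow>\<^sub>C real"
  obtains w :: "'k \<Rightarrow>\<^sub>C real" where "\<And>t. w t = min (z t) (x t)"
proof -
  have "(\<lambda>t. min (z t) (x t)) \<in> bcontfun"
  proof (rule bcontfun_normI)
    show "norm (min (z t) (x t)) \<le> norm z + norm x" for t
      using norm_bounded[of z t] norm_bounded[of x t] by (auto simp: min_def)
  qed (intro continuous_intros continuous_on_apply_bcontfun)
  then show thesis using that[of "Bcontfun (\<lambda>t. min (z t) (x t))"] by (simp add: Bcontfun_inverse)
qed

text \<open>The Riesz--Kantorovich formula: \<open>p x = Sup {\<mu> z |z. 0 \<le> z \<le> x}\<close> is additive on the
  positive cone, because each \<open>z\<close> between 0 and \<open>x + y\<close> splits as \<open>min z x + (z - min z x)\<close>.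
  It extends to all functions by \<open>n x = p (x + d) - p d\<close>, where \<open>d\<close> is any positive function
  that makes \<open>x + d\<close> positive; the constant \<open>norm x\<close> serves.\<close>

lemma positive_part_exists:
  fixes \<mu> :: "('k::topological_space \<Rightarrow>\<^sub>C real) dual"
  obtains \<nu> where "dual_le pointwise_le 0 \<nu>" "dual_le pointwise_le \<mu> \<nu>"
    "\<nu> (const_bcontfun 1) \<le> norm \<mu>"
proof -
  define I where "I x = {z :: 'k \<Rightarrow>\<^sub>C real. pointwise_le 0 z \<and> pointwise_le z x}" for x
  define p where "p x = Sup (blinfun_apply \<mu> ` I x)" for x
  have bound: "\<mu> z \<le> norm \<mu> * norm x" if "z \<in> I x" for x z
  proof -
    have "\<mu> z \<le> norm \<mu> * norm z" using norm_blinfun[of \<mu> z] by simp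
    also have "\<dots> \<le> norm \<mu> * norm x"
      using that norm_le_of_order_interval by (intro mult_left_mono) (auto simp: I_def)
    finally show ?thesis .
  qed
  have upper: "\<mu> z \<le> p x" if "z \<in> I x" for x z
    unfolding p_def using that bound by (intro cSUP_upper) (auto intro!: bdd_aboveI)
  have least: "p x \<le> b" if "pointwise_le 0 x" "\<And>z. z \<in> I x \<Longrightarrow> \<mu> z \<le> b" for x b
    unfolding p_def using that by (intro cSUP_least) (auto simp: I_def pointwise_le_def)
  have p_nonneg: "0 \<le> p x" if "pointwise_le 0 x" for x
    using upper[of 0 x] that by (simp add: I_def pointwise_le_def)
  have p_bound: "p x \<le> norm \<mu> * norm x" if "pointwise_le 0 x" for x
    using that bound by (rule least)
  have p_add: "p (x + y) = p x + p y" if x: "pointwise_le 0 x" and y: "pointwise_le 0 y" for x y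
  proof (rule antisym)
    show "p (x + y) \<le> p x + p y"
    proof (rule least)
      show "pointwise_le 0 (x + y)" using x y by (simp add: pointwise_le_def)
      fix z assume z: "z \<in> I (x + y)"
      obtain w where w: "\<And>t. apply_bcontfun w t = min (z t) (x t)" by (rule bcontfun_min[of z x]) (rule that)
      have "w \<in> I x" "z - w \<in> I y"
        using x y z by (auto simp: I_def pointwise_le_def w min_def algebra_simps)
      then have "\<mu> w + \<mu> (z - w) \<le> p x + p y" by (intro add_mono upper)
      then show "\<mu> z \<le> p x + p y" by (simp add: blinfun.diff_right)
    qed
    have "\<mu> z \<le> p (x + y) - p y" if z: "z \<in> I x" for z
    proof -
      have "\<mu> v \<le> p (x + y) - \<mu> z" if "v \<in> I y" for v
      proof -
        have "z + v \<in> I (x + y)"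
          using z that by (auto simp: I_def pointwise_le_def intro: add_mono)
        from upper[OF this] show ?thesis by (simp add: blinfun.add_right)
      qed
      then have "p y \<le> p (x + y) - \<mu> z" by (rule least[OF y])
      then show ?thesis by simp
    qed
    then have "p x \<le> p (x + y) - p y" by (rule least[OF x])
    then show "p x + p y \<le> p (x + y)" by simp
  qed
  have p_zero: "p 0 = 0"
    using p_add[of 0 0] by (simp add: pointwise_le_def)
  have scale_nonneg: "pointwise_le 0 (r *\<^sub>R x)" if "0 \<le> r" "pointwise_le 0 x" for r and x :: "'k \<Rightarrow>\<^sub>C real"
    using that by (simp add: pointwise_le_def)
  have p_scale_le: "p (r *\<^sub>R x) \<le> r * p x" if x: "pointwise_le 0 x" and r: "r > 0" for r x
  proof (rule least)
    show "pointwise_le 0 (r *\<^sub>R x)" using x r by (simp add: pointwise_le_def)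
    fix z assume z: "z \<in> I (r *\<^sub>R x)"
    have "z /\<^sub>R r \<in> I x" using z r by (auto simp: I_def pointwise_le_def field_simps)
    from upper[OF this] show "\<mu> z \<le> r * p x"
      using r by (simp add: blinfun.scaleR_right field_simps)
  qed
  have p_scale: "p (r *\<^sub>R x) = r * p x" if x: "pointwise_le 0 x" and r: "r \<ge> 0" for r x
  proof (cases "r = 0")
    case True
    then show ?thesis by (simp add: p_zero)
  next
    case False
    with r have r: "r > 0" by simp
    have "p ((1 / r) *\<^sub>R (r *\<^sub>R x)) \<le> 1 / r * p (r *\<^sub>R x)"
      using x r by (intro p_scale_le) (simp_all add: pointwise_le_def)
    then have "r * p x \<le> p (r *\<^sub>R x)" using r by (simp add: field_simps)
    with p_scale_le[OF x r] show ?thesis by simp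
  qed
  define one where "one = (const_bcontfun 1 :: 'k \<Rightarrow>\<^sub>C real)"
  have one: "one t = 1" for t by (simp add: one_def const_bcontfun.rep_eq)
  have norm_one: "norm one \<le> 1" using norm_const_bcontfun_le[of 1] by (simp add: one_def)
  define n where "n x = p (x + norm x *\<^sub>R one) - p (norm x *\<^sub>R one)" for x
  \<comment> \<open>The constant \<open>norm x\<close> is one admissible shift; \<open>n_eq\<close> shows that all of them give the same value.\<close>
  have shift: "pointwise_le 0 (norm x *\<^sub>R one)" "pointwise_le 0 (x + norm x *\<^sub>R one)" for x
  proof -
    have "0 \<le> x t + norm x" for t
      using norm_bounded[of x t] unfolding real_norm_def by linarith
    then show "pointwise_le 0 (x + norm x *\<^sub>R one)"
      by (simp add: pointwise_le_def one)
  qed (simp add: pointwise_le_def one)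
  have n_eq: "n x = p (x + d) - p d" if d: "pointwise_le 0 d" "pointwise_le 0 (x + d)" for x d
  proof -
    have "p (x + norm x *\<^sub>R one) + p d = p (x + d) + p (norm x *\<^sub>R one)"
      using p_add[OF shift(2)[of x] d(1)] p_add[OF d(2) shift(1)[of x]] by (simp add: ac_simps)
    then show ?thesis by (simp add: n_def)
  qed
  have n_pos: "n x = p x" if "pointwise_le 0 x" for x
    using n_eq[of 0 x] that by (simp add: p_zero pointwise_le_def)
  have n_add: "n (x + y) = n x + n y" for x y
  proof -
    let ?c = "norm x *\<^sub>R one" and ?d = "norm y *\<^sub>R one"
    have "pointwise_le 0 (?c + ?d)" "pointwise_le 0 ((x + ?c) + (y + ?d))"
      using shift[of x] shift[of y] by (auto simp: pointwise_le_def intro: add_nonneg_nonneg)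
    then have "n (x + y) = p ((x + ?c) + (y + ?d)) - p (?c + ?d)"
      using n_eq[of "?c + ?d" "x + y"] by (simp add: ac_simps)
    also have "\<dots> = n x + n y"
      using p_add[OF shift(2)[of x] shift(2)[of y]] p_add[OF shift(1)[of x] shift(1)[of y]]
      by (simp add: n_def)
    finally show ?thesis .
  qed
  have n_scale_nonneg: "n (r *\<^sub>R x) = r * n x" if r: "r \<ge> 0" for r x
  proof -
    let ?c = "norm x *\<^sub>R one"
    have "pointwise_le 0 (r *\<^sub>R ?c)" "pointwise_le 0 (r *\<^sub>R (x + ?c))"
      by (rule scale_nonneg[OF r shift(1)], rule scale_nonneg[OF r shift(2)])
    then have "n (r *\<^sub>R x) = p (r *\<^sub>R (x + ?c)) - p (r *\<^sub>R ?c)"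
      using n_eq[of "r *\<^sub>R ?c" "r *\<^sub>R x"] by (simp add: scaleR_add_right)
    also have "\<dots> = r * n x"
      using p_scale[OF shift(2)[of x] r] p_scale[OF shift(1)[of x] r]
      by (simp add: n_def right_diff_distrib)
    finally show ?thesis .
  qed
  have n_minus: "n (- x) = - n x" for x
    using n_add[of x "- x"] n_pos[of 0] by (simp add: p_zero pointwise_le_def)
  have "bounded_linear n"
  proof
    fix x y :: "'k \<Rightarrow>\<^sub>C real" and r :: real
    show "n (x + y) = n x + n y" by (rule n_add)
    show "n (r *\<^sub>R x) = r *\<^sub>R n x"
      using n_scale_nonneg[of r x] n_scale_nonneg[of "- r" x] n_minus[of "r *\<^sub>R x"]
      by (cases "r \<ge> 0") auto
  next
    have "norm (n x) \<le> norm x * (2 * norm \<mu>)" for x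
    proof -
      have c: "norm (norm x *\<^sub>R one) \<le> norm x"
        using mult_left_mono[OF norm_one, of "norm x"] by simp
      have "p (norm x *\<^sub>R one) \<le> norm \<mu> * norm (norm x *\<^sub>R one)"
        by (rule p_bound[OF shift(1)])
      also have "\<dots> \<le> norm \<mu> * (2 * norm x)"
        using c norm_ge_zero[of x] by (intro mult_left_mono norm_ge_zero) linarith
      finally have 1: "p (norm x *\<^sub>R one) \<le> norm x * (2 * norm \<mu>)" by (simp add: ac_simps)
      have "p (x + norm x *\<^sub>R one) \<le> norm \<mu> * norm (x + norm x *\<^sub>R one)"
        by (rule p_bound[OF shift(2)])
      also have "\<dots> \<le> norm \<mu> * (2 * norm x)"
        using c norm_triangle_ineq[of x "norm x *\<^sub>R one"]
        by (intro mult_left_mono norm_ge_zero) linarith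
      finally have 2: "p (x + norm x *\<^sub>R one) \<le> norm x * (2 * norm \<mu>)" by (simp add: ac_simps)
      show ?thesis
        using 1 2 p_nonneg[OF shift(1)[of x]] p_nonneg[OF shift(2)[of x]] by (simp add: n_def abs_le_iff)
    qed
    then show "\<exists>K. \<forall>x. norm (n x) \<le> norm x * K" by blast
  qed
  then have \<nu>: "blinfun_apply (Blinfun n) = n" by (rule bounded_linear_Blinfun_apply)
  show thesis
  proof (rule that[of "Blinfun n"])
    show "dual_le pointwise_le 0 (Blinfun n)"
      using p_nonneg by (simp add: dual_le_def \<nu> n_pos)
    show "dual_le pointwise_le \<mu> (Blinfun n)"
      using upper by (simp add: dual_le_def \<nu> n_pos I_def pointwise_le_def)
    have "pointwise_le 0 one" by (simp add: pointwise_le_def one)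
    then have "n one \<le> norm \<mu> * norm one" using p_bound by (simp add: n_pos)
    also have "\<dots> \<le> norm \<mu>" using mult_left_mono[OF norm_one, of "norm \<mu>"] by simp
    finally show "Blinfun n (const_bcontfun 1) \<le> norm \<mu>" by (simp add: \<nu> one_def)
  qed
qed

text \<open>A function in the unit ball lies between the constants \<open>-1\<close> and \<open>1\<close>, so \<open>\<mu> x\<close> lies between
  \<open>- \<mu> 1\<close> and \<open>\<mu> 1\<close>.\<close>

lemma norm_positive_functional_le:
  fixes \<mu> :: "('k::topological_space \<Rightarrow>\<^sub>C real) dual"
  assumes "dual_le pointwise_le 0 \<mu>"
  shows "norm \<mu> \<le> \<mu> (const_bcontfun 1)"
proof (rule norm_blinfun_le_ball[of 1])
  fix x :: "'k \<Rightarrow>\<^sub>C real"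
  assume "norm x \<le> 1"
  then have "0 \<le> 1 - x t \<and> 0 \<le> 1 + x t" for t
    using norm_bounded[of x t] unfolding real_norm_def by linarith
  then have "pointwise_le 0 (const_bcontfun 1 - x)" "pointwise_le 0 (const_bcontfun 1 + x)"
    by (simp_all add: pointwise_le_def const_bcontfun.rep_eq)
  then have "0 \<le> \<mu> (const_bcontfun 1 - x)" "0 \<le> \<mu> (const_bcontfun 1 + x)"
    using assms by (simp_all add: dual_le_def)
  then show "norm (\<mu> x) \<le> \<mu> (const_bcontfun 1) * 1"
    by (simp add: blinfun.diff_right blinfun.add_right abs_le_iff)
qed simp

text \<open>On the positive cone of the dual the functional \<open>u \<mu> = C * \<mu> 1\<close> dominates every functional
  of norm at most \<open>C\<close>, since \<open>norm \<mu> = \<mu> 1\<close> there. This order unit of the bidual bounds the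
  disjoint sums. For general \<open>\<mu>\<close>, write \<open>\<mu> = \<nu> - (\<nu> - \<mu>)\<close> with both parts positive; their
  values at \<open>1\<close> are at most \<open>norm \<mu>\<close> and \<open>2 * norm \<mu>\<close>, whence the factor 3.\<close>

lemma disjoint_bounded_wuc:
  fixes f :: "nat \<Rightarrow> ('k::topological_space \<Rightarrow>\<^sub>C real) dual dual"
  assumes disj: "disjoint_sequence (dual_le (dual_le pointwise_le)) f"
    and C: "\<And>n. norm (f n) \<le> C"
  shows "(\<Sum>m<N. \<bar>f m \<mu>\<bar>) \<le> 3 * C * norm \<mu>"
proof -
  have C0: "0 \<le> C" by (rule order_trans[OF norm_ge_zero C])
  define one where "one = (const_bcontfun 1 :: 'k \<Rightarrow>\<^sub>C real)"
  obtain ev :: "('k \<Rightarrow>\<^sub>C real) dual dual" where ev: "\<And>\<mu>. ev \<mu> = blinfun_apply \<mu> one"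
    by (rule evaluation_functional) (rule that)
  define u where "u = C *\<^sub>R ev"
  have u: "u \<mu> = C * \<mu> one" for \<mu>
    by (simp add: u_def blinfun.scaleR_left ev)
  have f_le: "\<bar>f n \<mu>\<bar> \<le> u \<mu>" if "dual_le pointwise_le 0 \<mu>" for n \<mu>
  proof -
    have "\<bar>f n \<mu>\<bar> \<le> C * norm \<mu>"
      using norm_blinfun[of "f n" \<mu>] mult_right_mono[OF C[of n], of "norm \<mu>"] by simp
    also have "\<dots> \<le> C * \<mu> one"
      unfolding one_def using C0 norm_positive_functional_le[OF that] by (rule mult_left_mono[rotated])
    finally show ?thesis by (simp add: u)
  qed
  have pos: "(\<Sum>m<N. \<bar>f m \<mu>\<bar>) \<le> C * \<mu> one" if "dual_le pointwise_le 0 \<mu>" for \<mu>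
  proof -
    have "(\<Sum>m<N. \<bar>f m \<mu>\<bar>) \<le> u \<mu>"
    proof (rule disjoint_sequence_sum_le[OF disj _ _ that])
      show "dual_le (dual_le pointwise_le) (f n) u" "dual_le (dual_le pointwise_le) (- f n) u" for n
        unfolding dual_le_def[of "dual_le pointwise_le"]
        using f_le[of _ n] by (simp_all add: blinfun.minus_left abs_le_iff)
    qed
    then show ?thesis by (simp add: u)
  qed
  obtain \<nu> where \<nu>: "dual_le pointwise_le 0 \<nu>" "dual_le pointwise_le \<mu> \<nu>" "\<nu> one \<le> norm \<mu>"
    by (rule positive_part_exists) (rule that, simp_all add: one_def)
  have diff: "dual_le pointwise_le 0 (\<nu> - \<mu>)"
    using \<nu>(2) by (simp add: dual_le_def blinfun.diff_left)
  have "norm one \<le> 1" using norm_const_bcontfun_le[of 1] by (simp add: one_def)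
  then have "norm \<mu> * norm one \<le> norm \<mu> * 1" by (rule mult_left_mono) simp
  then have "\<bar>\<mu> one\<bar> \<le> norm \<mu>"
    using norm_blinfun[of \<mu> one] unfolding real_norm_def by linarith
  then have "(\<nu> - \<mu>) one \<le> 2 * norm \<mu>"
    using \<nu>(3) by (simp add: blinfun.diff_left)
  then have "C * (\<nu> - \<mu>) one \<le> C * (2 * norm \<mu>)" using C0 by (rule mult_left_mono)
  moreover have "C * \<nu> one \<le> C * norm \<mu>" using \<nu>(3) C0 by (rule mult_left_mono)
  moreover have "(\<Sum>m<N. \<bar>f m \<mu>\<bar>) \<le> (\<Sum>m<N. \<bar>f m \<nu>\<bar> + \<bar>f m (\<nu> - \<mu>)\<bar>)"
  proof (rule sum_mono)
    show "\<bar>f m \<mu>\<bar> \<le> \<bar>f m \<nu>\<bar> + \<bar>f m (\<nu> - \<mu>)\<bar>" for m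
      unfolding blinfun.diff_right by linarith
  qed
  ultimately show ?thesis
    using pos[OF \<nu>(1)] pos[OF diff] unfolding sum.distrib by simp
qed

section \<open>Almost limited adjoints\<close>

theorem corollary4p5:
  fixes T :: "('k::t2_space \<Rightarrow>\<^sub>C real) \<Rightarrow>\<^sub>L 'x::banach"
  assumes "compact (UNIV :: 'k set)"
    and "weakly_compact_operator T"
  shows "almost_limited (dual_le pointwise_le) (dual_adjoint T) \<and>
         almost_dunford_pettis (dual_le (dual_le pointwise_le)) (dual_adjoint (dual_adjoint T))"
proof -
  have null: "norm_null (\<lambda>n. dual_adjoint (dual_adjoint T) (f n))"
    if disj: "disjoint_sequence (dual_le (dual_le pointwise_le)) f" and "weak_star_null f" for f
  proof -
    have "\<exists>K. \<forall>n. norm (f n \<mu>) \<le> K" for \<mu>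
    proof -
      have "(\<lambda>n. f n \<mu>) \<longlonglongrightarrow> 0" using that(2) by (simp add: weak_star_null_iff)
      then have "Bseq (\<lambda>n. f n \<mu>)" by (rule convergent_imp_Bseq[OF convergentI])
      then show ?thesis by (rule BseqE) (rule exI)
    qed
    then obtain C where C: "\<And>n. norm (f n) \<le> C"
      by (rule uniform_boundedness) (rule that)
    show ?thesis
      unfolding norm_null_def
      by (rule weakly_compact_biadjoint_null[OF assms(2) disjoint_bounded_wuc[OF disj C]])
  qed
  moreover have "weak_star_null f" if "weakly_null f" for f :: "nat \<Rightarrow> ('k \<Rightarrow>\<^sub>C real) dual dual"
    unfolding weak_star_null_iff
  proof
    fix \<mu> :: "('k \<Rightarrow>\<^sub>C real) dual"
    obtain ev :: "('k \<Rightarrow>\<^sub>C real) dual dual dual" where ev: "\<And>f. ev f = blinfun_apply f \<mu>"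
      by (rule evaluation_functional) (rule that)
    have "(\<lambda>n. ev (f n)) \<longlonglongrightarrow> 0"
      using that unfolding weakly_null_iff by (rule spec)
    then show "(\<lambda>n. f n \<mu>) \<longlonglongrightarrow> 0" by (simp only: ev)
  qed
  ultimately show ?thesis
    unfolding almost_limited_def almost_dunford_pettis_def by simp
qed

end
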